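(* There exists a global constant $\mathbf K>0$ such that the following holds. Let $M,L\in\mathbb N$ with $2\le L\le2\sqrt M$ and $L<M$, let $a_0\in[0,M-L]$ be an integer, and consider the alphabet $$\mathcal A=a_0+\{0,1,\dots,L-1\}\subset\{0,\dots,M-1\}.$$ Then, with $\delta=\log L/\log M$, the fractal uncertainty exponent $\beta=\beta(M,\mathcal A)$ satisfies $$\beta\ \le\ \frac12-\delta+\frac{\mathbf KL^2}{M\log M}.$$
   Context: $\mathbb Z_N=\mathbb Z/N\mathbb Z\simeq\{0,\dots,N-1\}$; $\ell^2_N$ is the space of functions $u:\mathbb Z_N\to\mathbb C$ with $\|u\|_{\ell^2_N}^2=\sum_j|u(j)|^2$; $\mathcal F_Nu(j)=\frac1{\sqrt N}\sum_{\ell=0}^{N-1}\exp(-2\pi ij\ell/N)u(\ell)$; $\mathbf 1_X$ is multiplication by the indicator function of $X\subset\mathbb Z_N$. For $N=M^k$: $\mathcal C_k=\{\sum_{j=0}^{k-1}a_jM^j\mid a_0,\dots,a_{k-1}\in\mathcal A\}\subset\mathbb Z_N$ and $r_k=\|\mathbf 1_{\mathcal C_k}\mathcal F_N\mathbf 1_{\mathcal C_k}\|_{\ell^2_N\to\ell^2_N}$. The fractal uncertainty exponent is $\beta(M,\mathcal A)=-\lim_{k\to\infty}\frac{\log r_k}{k\log M}$ (the limit exists). *)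

theory Defs
  imports "HOL-Analysis.Analysis"
begin

text \<open>
  A function on \<open>\<int>\<^sub>N \<simeq> {0,\<dots>,N-1}\<close> is represented by some \<open>u :: nat \<Rightarrow> complex\<close> of which only
  the values on \<open>{..<N}\<close> matter: the norm and the Fourier transform below do not depend on the
  values of \<open>u\<close> outside \<open>{..<N}\<close>. The size \<open>N\<close> is a term, not a type, because it varies
  with \<open>k\<close> in the limit defining the exponent.
\<close>

definition l2_norm :: "nat \<Rightarrow> (nat \<Rightarrow> complex) \<Rightarrow> real" where
  "l2_norm N u = sqrt (\<Sum>j<N. (cmod (u j))\<^sup>2)"

definition dft :: "nat \<Rightarrow> (nat \<Rightarrow> complex) \<Rightarrow> nat \<Rightarrow> complex" where
  "dft N u j = 1 / complex_of_real (sqrt (real N)) *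
     (\<Sum>l<N. exp (- 2 * complex_of_real pi * \<i> * of_nat j * of_nat l / of_nat N) * u l)"

definition ind_mult :: "nat set \<Rightarrow> (nat \<Rightarrow> complex) \<Rightarrow> nat \<Rightarrow> complex" where
  "ind_mult X u = (\<lambda>j. indicator X j * u j)"

text \<open>
  The operator norm from \<open>\<ell>\<^sup>2\<^sub>N\<close> to itself, in the same form as \<^const>\<open>onorm\<close>, which is not applicable
  since its domain is a whole type. Functions vanishing on \<open>{..<N}\<close> contribute \<open>x / 0 = 0\<close>. The
  supremum is meaningful for linear operators that only depend on the values on \<open>{..<N}\<close>, whose
  quotients are bounded.
\<close>

definition l2_onorm :: "nat \<Rightarrow> ((nat \<Rightarrow> complex) \<Rightarrow> nat \<Rightarrow> complex) \<Rightarrow> real" where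
  "l2_onorm N T = (SUP u. l2_norm N (T u) / l2_norm N u)"

definition cantor_set :: "nat \<Rightarrow> nat set \<Rightarrow> nat \<Rightarrow> nat set" where
  "cantor_set M A k = {\<Sum>j<k. a j * M ^ j | a. \<forall>j<k. a j \<in> A}"

definition fup_norm :: "nat \<Rightarrow> nat set \<Rightarrow> nat \<Rightarrow> real" where
  "fup_norm M A k =
     l2_onorm (M ^ k) (ind_mult (cantor_set M A k) \<circ> dft (M ^ k) \<circ> ind_mult (cantor_set M A k))"

definition fup_exponent :: "nat \<Rightarrow> nat set \<Rightarrow> real" where
  "fup_exponent M A = - lim (\<lambda>k. ln (fup_norm M A k) / (real k * ln (real M)))"

end

theory Submission
  imports Defs
begin

text \<open>
  Write \<open>C\<close> for the Cantor set with \<open>k\<close> digits, \<open>N = M\<^sup>k\<close>, and \<open>e(\<theta>) = exp (2\<pi>i\<theta>)\<close>. An upper bound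
  on the exponent is a lower bound on the norms \<open>r\<^sub>k\<close>, so one good test function for each \<open>k\<close>
  suffices. Let \<open>c\<close> be the least element of \<open>C\<close>, the number all of whose digits are \<open>a0\<close>.
  The test function \<open>u(y) = e(c y / N)\<close> on \<open>C\<close> has a Fourier transform that is large on all of \<open>C\<close>:
  its value at \<open>c + z\<close> is, up to normalisation, the sum of \<open>e(- z y / N)\<close> over \<open>y \<in> C\<close>. The digits of
  \<open>y\<close> are independent, so this sum is a product of \<open>k\<close> Dirichlet sums over \<open>{0..<L}\<close>. Only the
  fractional part \<open>t\<close> of \<open>z / M\<^sup>m\<close> enters a factor, and \<open>t \<le> (L - 1) / (M - 1)\<close>, because all digits of
  \<open>z\<close> are below \<open>L\<close>. Hence all phases in a factor are at most \<open>L\<^sup>2 / M\<close>, and when this is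
  small the factor is at least \<open>L (1 - 2 L\<^sup>2 / M)\<close> in modulus. Comparing norms yields
  \<open>r\<^sub>k \<ge> (L (1 - 2 L\<^sup>2 / M) / sqrt M)\<^sup>k\<close>, which is the claim up to taking logarithms.

  When \<open>L\<^sup>2 / M\<close> is not small, the same test function is built on a shorter interval
  \<open>a0 + {0..<n}\<close> of digits with \<open>n \<ge> L / 14\<close>, short enough for its phases to be small, and the output is
  observed on the smaller Cantor set only (lemma \<open>fup_norm_lower\<close>). This loses a bounded factor
  for each digit, which a large constant \<open>K\<close> absorbs because \<open>L\<^sup>2 / M\<close> is bounded below.

  The exponent is defined through a limit, so a bound for every \<open>k\<close> is informative only once the
  limit is known to exist. This holds by Fekete's lemma
  (\<open>subadditive_imp_convergent_quotient\<close>), since \<open>r\<^sub>k\<close> is submultiplicative (\<open>fup_norm_submult\<close>):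
  splitting the digits as in the Cooley-Tukey fast Fourier transform factors the transform of size
  \<open>M\<^sup>k\<^sup>+\<^sup>l\<close> into transforms of sizes \<open>M\<^sup>k\<close> and \<open>M\<^sup>l\<close> and a multiplication by unimodular numbers.
\<close>

section \<open>Fekete's lemma\<close>

text \<open>
  The limit is the infimum of the quotients. Given \<open>m\<close> with \<open>a m / m\<close> close to the infimum, division with
  remainder \<open>n = q m + r\<close> gives \<open>a n \<le> q a m + a r\<close>, and the remainder term is bounded.
\<close>

lemma subadditive_imp_convergent_quotient:
  fixes a :: "nat \<Rightarrow> real"
  assumes sub: "\<And>m n. a (m + n) \<le> a m + a n"
    and lower: "\<And>n. n > 0 \<Longrightarrow> c \<le> a n / real n"
  shows "convergent (\<lambda>n. a n / real n)"
proof -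
  define l where "l = (INF n\<in>{0<..}. a n / real n)"
  have bdd: "bdd_below ((\<lambda>n. a n / real n) ` {0<..})"
    using lower by (intro bdd_belowI2[of _ c]) auto
  have l_le: "l \<le> a n / real n" if "n > 0" for n
    unfolding l_def by (rule cINF_lower[OF bdd]) (use that in auto)
  have mult: "a (q * m + r) \<le> real q * a m + a r" for q m r
  proof (induction q)
    case (Suc q)
    have "a (Suc q * m + r) = a (m + (q * m + r))" by (simp add: add.assoc)
    also have "\<dots> \<le> a m + a (q * m + r)" by (rule sub)
    finally show ?case using Suc by (simp add: algebra_simps)
  qed simp
  have "(\<lambda>n. a n / real n) \<longlonglongrightarrow> l"
  proof (rule LIMSEQ_I)
    fix e :: real assume e: "e > 0"
    have "\<exists>m\<in>{0<..}. a m / real m < l + e / 2"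
      using cINF_less_iff[OF _ bdd, of "l + e / 2"] e unfolding l_def by auto
    then obtain m where m: "m > 0" "a m / real m < l + e / 2" by auto
    define B where "B = (\<Sum>r<m. \<bar>a r\<bar>) + \<bar>a m\<bar>"
    have B0: "B \<ge> 0" unfolding B_def by (intro add_nonneg_nonneg sum_nonneg) auto
    obtain n0 :: nat where n0: "real n0 > 2 * B / e" using reals_Archimedean2 by blast
    have "norm (a n / real n - l) < e" if n: "n \<ge> max n0 1" for n
    proof -
      have npos: "n > 0" using n by auto
      define q r where "q = n div m" and "r = n mod m"
      have nqr: "n = q * m + r" "r < m" using m by (auto simp: q_def r_def)
      have "\<bar>a r\<bar> \<le> (\<Sum>r<m. \<bar>a r\<bar>)"
        by (rule member_le_sum) (use nqr in auto)
      moreover have "real q * a m \<le> real n * (a m / real m) + \<bar>a m\<bar>"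
      proof -
        have "real q * a m = real n * (a m / real m) - (real r / real m) * a m"
          using m(1) by (simp add: nqr field_simps)
        moreover have "\<bar>(real r / real m) * a m\<bar> \<le> 1 * \<bar>a m\<bar>"
          unfolding abs_mult by (rule mult_right_mono) (use nqr in auto)
        ultimately show ?thesis by linarith
      qed
      moreover have "a n \<le> real q * a m + a r" using mult nqr by metis
      ultimately have "a n \<le> real n * (a m / real m) + B" unfolding B_def by linarith
      hence "a n / real n \<le> a m / real m + B / real n"
        using npos by (simp add: field_simps)
      moreover have "B / real n < e / 2"
      proof -
        have "2 * B / e < real n" using n0 n by linarith
        thus ?thesis using e npos by (simp add: field_simps)
      qed
      ultimately have "a n / real n < l + e" using m(2) by linarith
      thus ?thesis using l_le[OF npos] by auto
    qed
    thus "\<exists>n0. \<forall>n\<ge>n0. norm (a n / real n - l) < e" by blast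
  qed
  thus ?thesis by (auto simp: convergent_def)
qed

section \<open>The localised Fourier transform as a quadratic form inequality\<close>

text \<open>
  The discrete Fourier transform of \<open>u\<close> restricted to \<open>C\<close>, without the factor \<open>1 / sqrt N\<close>, so
  that the digit splittings below produce no stray square roots.
\<close>

definition char_sum :: "nat \<Rightarrow> nat set \<Rightarrow> (nat \<Rightarrow> complex) \<Rightarrow> nat \<Rightarrow> complex" where
  "char_sum N C u x = (\<Sum>y\<in>C. cis (- (2 * pi * (real x * real y) / real N)) * u y)"

lemma l2_norm_localized_dft:
  assumes "C \<subseteq> {..<N}"
  shows "(l2_norm N ((ind_mult C \<circ> dft N \<circ> ind_mult C) u))\<^sup>2 =
    (\<Sum>x\<in>C. (cmod (char_sum N C u x))\<^sup>2) / real N"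
proof -
  have 1: "dft N (ind_mult C u) x = char_sum N C u x / complex_of_real (sqrt (real N))" for x
  proof -
    have "(\<Sum>l<N. exp (- 2 * complex_of_real pi * \<i> * of_nat x * of_nat l / of_nat N) * ind_mult C u l)
      = (\<Sum>l\<in>C. exp (- 2 * complex_of_real pi * \<i> * of_nat x * of_nat l / of_nat N) * ind_mult C u l)"
      using assms by (intro sum.mono_neutral_right) (auto simp: ind_mult_def indicator_def)
    also have "\<dots> = char_sum N C u x"
      unfolding char_sum_def ind_mult_def cis_conv_exp
      by (intro sum.cong refl) (simp add: indicator_def mult_ac)
    finally show ?thesis unfolding dft_def by simp
  qed
  have "(l2_norm N ((ind_mult C \<circ> dft N \<circ> ind_mult C) u))\<^sup>2 =
    (\<Sum>x<N. (cmod (indicator C x * (char_sum N C u x / complex_of_real (sqrt (real N)))))\<^sup>2)"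
    unfolding l2_norm_def by (subst real_sqrt_pow2) (auto intro: sum_nonneg simp: ind_mult_def[of C "dft _ _"] 1)
  also have "\<dots> = (\<Sum>x\<in>C. (cmod (char_sum N C u x))\<^sup>2 / real N)"
    using assms by (intro sum.mono_neutral_cong_right) 
      (auto simp: norm_divide power_divide indicator_def)
  finally show ?thesis by (simp add: sum_divide_distrib)
qed

lemma l2_norm_sq: "(l2_norm N u)\<^sup>2 = (\<Sum>j<N. (cmod (u j))\<^sup>2)"
  unfolding l2_norm_def by (simp add: sum_nonneg)

lemma l2_norm_nonneg: "l2_norm N u \<ge> 0"
  unfolding l2_norm_def by (simp add: sum_nonneg)

lemma char_sum_Cauchy_Schwarz:
  assumes "C \<subseteq> {..<N}"
  shows "(cmod (char_sum N C u x))\<^sup>2 \<le> real N * (\<Sum>j<N. (cmod (u j))\<^sup>2)"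
proof -
  have "cmod (char_sum N C u x) \<le> (\<Sum>y\<in>C. cmod (u y))"
    unfolding char_sum_def by (rule order_trans[OF norm_sum]) (simp add: norm_mult)
  also have "\<dots> \<le> (\<Sum>y<N. cmod (u y))"
    using assms by (intro sum_mono2) auto
  finally have "(cmod (char_sum N C u x))\<^sup>2 \<le> (\<Sum>y<N. cmod (u y))\<^sup>2"
    by (intro power_mono) auto
  also have "\<dots> \<le> (\<Sum>j<N. (cmod (u j))\<^sup>2) * real (card {..<N})"
    by (rule sum_squared_le_sum_of_squares) 
  finally show ?thesis by (simp add: mult_ac)
qed

text \<open>
  The supremum defining the operator norm carries information only for a bounded set of quotients;
  by the Cauchy-Schwarz inequality \<open>sqrt N\<close> is a crude bound.
\<close>

lemma bdd_above_localized_dft: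
  assumes "C \<subseteq> {..<N}"
  shows "bdd_above (range (\<lambda>u. l2_norm N ((ind_mult C \<circ> dft N \<circ> ind_mult C) u) / l2_norm N u))"
proof (rule bdd_aboveI2)
  fix u
  have "(l2_norm N ((ind_mult C \<circ> dft N \<circ> ind_mult C) u))\<^sup>2
      \<le> (\<Sum>x\<in>C. real N * (\<Sum>j<N. (cmod (u j))\<^sup>2)) / real N"
    unfolding l2_norm_localized_dft[OF assms]
    by (intro divide_right_mono sum_mono char_sum_Cauchy_Schwarz assms) auto
  also have "\<dots> \<le> real N * (l2_norm N u)\<^sup>2"
    using card_mono[OF _ assms] by (auto simp: l2_norm_sq intro!: mult_right_mono sum_nonneg)
  also have "\<dots> = (sqrt (real N) * l2_norm N u)\<^sup>2" by (simp add: power_mult_distrib)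
  finally have "l2_norm N ((ind_mult C \<circ> dft N \<circ> ind_mult C) u) \<le> sqrt (real N) * l2_norm N u"
    by (rule power2_le_imp_le) (simp add: l2_norm_nonneg)
  thus "l2_norm N ((ind_mult C \<circ> dft N \<circ> ind_mult C) u) / l2_norm N u \<le> sqrt (real N)"
    using l2_norm_nonneg[of N u] by (cases "l2_norm N u = 0") (auto simp: field_simps)
qed

abbreviation localized_dft_norm :: "nat \<Rightarrow> nat set \<Rightarrow> real" where
  "localized_dft_norm N C \<equiv> l2_onorm N (ind_mult C \<circ> dft N \<circ> ind_mult C)"

lemma localized_dft_norm_nonneg:
  assumes "C \<subseteq> {..<N}"
  shows "localized_dft_norm N C \<ge> 0"
proof -
  have "0 \<le> l2_norm N ((ind_mult C \<circ> dft N \<circ> ind_mult C) (\<lambda>_. 0)) / l2_norm N (\<lambda>_. 0)"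
    by (simp add: l2_norm_nonneg)
  also have "\<dots> \<le> localized_dft_norm N C"
    unfolding l2_onorm_def by (rule cSUP_upper[OF _ bdd_above_localized_dft[OF assms]]) simp
  finally show ?thesis .
qed

text \<open>
  This and the converse \<open>localized_dft_norm_leI\<close> below characterise the operator norm by an inequality
  between finite sums over \<open>C\<close>.
\<close>

lemma char_sum_norm_le:
  assumes "C \<subseteq> {..<N}" "N > 0"
  shows "(\<Sum>x\<in>C. (cmod (char_sum N C u x))\<^sup>2)
    \<le> real N * (localized_dft_norm N C)\<^sup>2 * (\<Sum>y\<in>C. (cmod (u y))\<^sup>2)"
proof -
  let ?T = "ind_mult C \<circ> dft N \<circ> ind_mult C"
  let ?v = "ind_mult C u"
  have le: "l2_norm N (?T ?v) \<le> localized_dft_norm N C * l2_norm N ?v"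
  \<comment> \<open>The quotient is \<open>0\<close> by convention when the norm of \<open>?v\<close> is zero, so the bound then needs its own argument.\<close>
  proof (cases "l2_norm N ?v = 0")
    case True
    hence "(\<Sum>j<N. (cmod (?v j))\<^sup>2) = 0" using l2_norm_sq[of N ?v] by simp
    hence "(l2_norm N (?T ?v))\<^sup>2 \<le> 0"
      unfolding l2_norm_localized_dft[OF assms(1)]
      using char_sum_Cauchy_Schwarz[OF assms(1), of ?v]
      by (auto simp: sum_nonneg_eq_0_iff intro!: divide_nonpos_nonneg sum_nonpos)
    thus ?thesis using True by simp
  next
    case False
    hence "l2_norm N ?v > 0" using l2_norm_nonneg[of N ?v] by simp
    moreover have "l2_norm N (?T ?v) / l2_norm N ?v \<le> localized_dft_norm N C"
      unfolding l2_onorm_def by (rule cSUP_upper[OF _ bdd_above_localized_dft[OF assms(1)]]) simp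
    ultimately show ?thesis by (simp add: field_simps)
  qed
  have "(l2_norm N (?T ?v))\<^sup>2 \<le> (localized_dft_norm N C * l2_norm N ?v)\<^sup>2"
    by (rule power_mono[OF le l2_norm_nonneg])
  moreover have "char_sum N C ?v = char_sum N C u"
    unfolding char_sum_def ind_mult_def by (intro ext sum.cong) auto
  moreover have "(l2_norm N ?v)\<^sup>2 = (\<Sum>y\<in>C. (cmod (u y))\<^sup>2)"
    unfolding l2_norm_sq using assms
    by (intro sum.mono_neutral_cong_right) (auto simp: ind_mult_def indicator_def)
  ultimately show ?thesis
    unfolding l2_norm_localized_dft[OF assms(1)] using assms
    by (simp only: power_mult_distrib) (simp add: field_simps)
qed

lemma localized_dft_norm_leI:
  assumes "C \<subseteq> {..<N}" "N > 0" "c \<ge> 0"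
    and bound: "\<And>u. (\<Sum>x\<in>C. (cmod (char_sum N C u x))\<^sup>2) \<le> real N * c\<^sup>2 * (\<Sum>y\<in>C. (cmod (u y))\<^sup>2)"
  shows "localized_dft_norm N C \<le> c"
  unfolding l2_onorm_def
proof (rule cSUP_least)
  fix u
  have "(l2_norm N ((ind_mult C \<circ> dft N \<circ> ind_mult C) u))\<^sup>2 \<le> c\<^sup>2 * (\<Sum>y\<in>C. (cmod (u y))\<^sup>2)"
    unfolding l2_norm_localized_dft[OF assms(1)] using bound[of u] assms by (simp add: field_simps)
  also have "\<dots> \<le> c\<^sup>2 * (l2_norm N u)\<^sup>2"
    unfolding l2_norm_sq using assms by (intro mult_left_mono sum_mono2) auto
  finally have "(l2_norm N ((ind_mult C \<circ> dft N \<circ> ind_mult C) u))\<^sup>2 \<le> (c * l2_norm N u)\<^sup>2"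
    by (simp add: power_mult_distrib)
  hence "l2_norm N ((ind_mult C \<circ> dft N \<circ> ind_mult C) u) \<le> c * l2_norm N u"
    by (rule power2_le_imp_le) (simp add: assms l2_norm_nonneg)
  thus "l2_norm N ((ind_mult C \<circ> dft N \<circ> ind_mult C) u) / l2_norm N u \<le> c"
    using l2_norm_nonneg[of N u] assms(3) by (cases "l2_norm N u = 0") (auto simp: field_simps)
qed simp

section \<open>Digit arithmetic on Cantor sets\<close>

lemma cantor_set_0 [simp]: "cantor_set M A 0 = {0}"
  unfolding cantor_set_def by simp

lemma cantor_set_1: "cantor_set M A (Suc 0) = A"
proof -
  have "x \<in> cantor_set M A (Suc 0)" if "x \<in> A" for x
    unfolding cantor_set_def using that by (auto intro!: exI[of _ "\<lambda>_. x"])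
  thus ?thesis unfolding cantor_set_def by auto
qed

lemma cantor_set_add:
  "cantor_set M A (k + l) = (\<lambda>(x, y). x + M ^ k * y) ` (cantor_set M A k \<times> cantor_set M A l)"
proof -
  have split: "(\<Sum>j<k+l. f j) = (\<Sum>j<k. f j) + (\<Sum>j<l. f (k + j))" for f :: "nat \<Rightarrow> nat"
    by (induction l) (auto simp: add.assoc)
  show ?thesis
  proof (intro set_eqI iffI)
    fix z assume "z \<in> cantor_set M A (k + l)"
    then obtain a where a: "z = (\<Sum>j<k+l. a j * M ^ j)" "\<forall>j<k+l. a j \<in> A"
      unfolding cantor_set_def by auto
    have "z = (\<Sum>j<k. a j * M ^ j) + M ^ k * (\<Sum>j<l. a (k + j) * M ^ j)"
      unfolding a split by (simp add: sum_distrib_left power_add mult_ac)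
    moreover have "(\<Sum>j<k. a j * M ^ j) \<in> cantor_set M A k"
      unfolding cantor_set_def using a by auto
    moreover have "(\<Sum>j<l. a (k + j) * M ^ j) \<in> cantor_set M A l"
      unfolding cantor_set_def using a by (auto intro!: exI[of _ "\<lambda>j. a (k + j)"])
    ultimately show "z \<in> (\<lambda>(x, y). x + M ^ k * y) ` (cantor_set M A k \<times> cantor_set M A l)"
      by auto
  next
    fix z assume "z \<in> (\<lambda>(x, y). x + M ^ k * y) ` (cantor_set M A k \<times> cantor_set M A l)"
    then obtain a b where ab: "z = (\<Sum>j<k. a j * M ^ j) + M ^ k * (\<Sum>j<l. b j * M ^ j)"
      "\<forall>j<k. a j \<in> A" "\<forall>j<l. b j \<in> A"
      unfolding cantor_set_def by auto
    define c where "c j = (if j < k then a j else b (j - k))" for j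
    have "z = (\<Sum>j<k+l. c j * M ^ j)"
      unfolding split ab by (simp add: c_def sum_distrib_left power_add mult_ac)
    moreover have "\<forall>j<k+l. c j \<in> A" using ab by (auto simp: c_def)
    ultimately show "z \<in> cantor_set M A (k + l)" unfolding cantor_set_def by auto
  qed
qed

lemma cantor_set_Suc:
  "cantor_set M A (Suc k) = (\<lambda>(x, a). x + M ^ k * a) ` (cantor_set M A k \<times> A)"
  using cantor_set_add[of M A k "Suc 0"] by (simp add: cantor_set_1)

lemma cantor_set_less:
  assumes "A \<subseteq> {..<M}"
  shows "cantor_set M A k \<subseteq> {..<M ^ k}"
proof (induction k)
  case (Suc k)
  have "x + M ^ k * a < M ^ Suc k" if "x < M ^ k" "a < M" for x a
  proof -
    have "x + M ^ k * a < M ^ k * Suc a" using that by simp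
    also have "\<dots> \<le> M ^ k * M" using that by (intro mult_le_mono2) auto
    finally show ?thesis by (simp add: mult.commute)
  qed
  thus ?case using Suc assms unfolding cantor_set_Suc by auto
qed simp

text \<open>
  Since the digits are below \<open>M\<close>, the lowest \<open>k\<close> digits of \<open>z\<close> can be recovered from \<open>z\<close> modulo
  \<open>M\<^sup>k\<close>, so cutting a digit string in two parametrises the Cantor set without repetition.
\<close>

lemma sum_cantor_set_add:
  assumes "A \<subseteq> {..<M}"
  shows "(\<Sum>z\<in>cantor_set M A (k + l). f z) =
    (\<Sum>x\<in>cantor_set M A k. \<Sum>y\<in>cantor_set M A l. f (x + M ^ k * y))"
proof -
  have "inj_on (\<lambda>(x, y). x + M ^ k * y) (cantor_set M A k \<times> cantor_set M A l)"
  proof (rule inj_onI, clarify)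
    fix x y x' y'
    assume x: "x \<in> cantor_set M A k" "x' \<in> cantor_set M A k"
      and eq: "x + M ^ k * y = x' + M ^ k * y'"
    have lt: "x < M ^ k" "x' < M ^ k" using cantor_set_less[OF assms, of k] x by auto
    have "x = (x + M ^ k * y) mod M ^ k" using lt by simp
    also have "\<dots> = x'" unfolding eq using lt by simp
    finally have "x = x'" .
    moreover from this have "M ^ k * y = M ^ k * y'" using eq by linarith
    ultimately show "x = x' \<and> y = y'" using lt by (metis mult_left_cancel not_less_zero)
  qed
  thus ?thesis
    unfolding cantor_set_add sum.cartesian_product by (subst sum.reindex) (auto simp: case_prod_unfold)
qed

lemma card_cantor_set:
  assumes "A \<subseteq> {..<M}"
  shows "card (cantor_set M A k) = card A ^ k"
proof (induction k)
  case (Suc k)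
  have "card (cantor_set M A (Suc k)) = (\<Sum>z\<in>cantor_set M A (k + Suc 0). 1)" by simp
  also have "\<dots> = card (cantor_set M A k) * card A"
    by (subst sum_cantor_set_add[OF assms]) (simp add: cantor_set_1)
  finally show ?case using Suc by simp
qed simp

text \<open>
  A character is multiplicative and the digits of \<open>y\<close> range independently over \<open>A\<close>, so the
  Fourier transform of the Cantor set is a Riesz product.
\<close>

lemma sum_cis_cantor_set:
  assumes "A \<subseteq> {..<M}"
  shows "(\<Sum>y\<in>cantor_set M A k. cis (\<theta> * real y)) =
    (\<Prod>j<k. \<Sum>a\<in>A. cis (\<theta> * real a * real (M ^ j)))"
proof (induction k)
  case (Suc k)
  have "(\<Sum>y\<in>cantor_set M A (k + Suc 0). cis (\<theta> * real y)) =
    (\<Sum>x\<in>cantor_set M A k. \<Sum>a\<in>A. cis (\<theta> * real x) * cis (\<theta> * real a * real (M ^ k)))"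
    by (subst sum_cantor_set_add[OF assms])
       (auto simp: cantor_set_1 cis_mult algebra_simps intro!: sum.cong)
  also have "\<dots> = (\<Sum>x\<in>cantor_set M A k. cis (\<theta> * real x)) * (\<Sum>a\<in>A. cis (\<theta> * real a * real (M ^ k)))"
    by (simp add: sum_product)
  finally show ?case using Suc by simp
qed simp

lemma cantor_set_mod:
  assumes "A \<subseteq> {..<M}" "z \<in> cantor_set M A k" "m \<le> k"
  shows "z mod M ^ m \<in> cantor_set M A m"
proof -
  obtain l where "k = m + l" using assms(3) le_Suc_ex by blast
  then obtain x y where "x \<in> cantor_set M A m" "z = x + M ^ m * y"
    using assms(2) by (auto simp: cantor_set_add)
  thus ?thesis using cantor_set_less[OF assms(1), of m] by auto
qed

text \<open>
  The largest element has all digits equal to \<open>n - 1\<close>, a geometric sum. Multiplying by \<open>M - 1\<close>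
  avoids the division.
\<close>

lemma cantor_set_initial_le:
  assumes "z \<in> cantor_set M {..<n} m" "M > 0"
  shows "real z * (real M - 1) \<le> (real n - 1) * (real (M ^ m) - 1)"
  using assms
proof (induction m arbitrary: z)
  case (Suc m)
  then obtain x a where xa: "z = x + M ^ m * a" "x \<in> cantor_set M {..<n} m" "a < n"
    by (auto simp: cantor_set_Suc)
  have "real z * (real M - 1) = real x * (real M - 1) + real a * (real (M ^ m) * (real M - 1))"
    unfolding xa by (simp add: algebra_simps)
  also have "\<dots> \<le> (real n - 1) * (real (M ^ m) - 1) + (real n - 1) * (real (M ^ m) * (real M - 1))"
    using xa Suc by (intro add_mono Suc.IH mult_right_mono) auto
  also have "\<dots> = (real n - 1) * (real (M ^ Suc m) - 1)" by (simp add: algebra_simps)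
  finally show ?case .
qed simp

lemma cantor_set_translate:
  "cantor_set M ((\<lambda>j. a0 + j) ` B) k = (\<lambda>z. a0 * (\<Sum>j<k. M ^ j) + z) ` cantor_set M B k"
proof (induction k)
  case (Suc k)
  show ?case unfolding cantor_set_Suc Suc.IH
    by (force simp: image_iff algebra_simps)
qed simp

lemma cantor_set_mono: "A \<subseteq> B \<Longrightarrow> cantor_set M A k \<subseteq> cantor_set M B k"
  unfolding cantor_set_def by blast

section \<open>Submultiplicativity of the norms\<close>

lemma cis_minus_2pi_nat: "cis (- (2 * pi * real n)) = 1"
  using cis_multiple_2pi[of "real n"] by (simp add: cis_cnj[symmetric])

text \<open>
  One step of the Cooley-Tukey factorisation. With \<open>x = x1 + M\<^sup>k x2\<close> and, in the opposite order,
  \<open>y = y2 + M\<^sup>l y1\<close>, the number \<open>x y / M\<^sup>k\<^sup>+\<^sup>l\<close> is the sum of \<open>x2 y2 / M\<^sup>l\<close>, \<open>x1 y1 / M\<^sup>k\<close>, the twiddle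
  phase \<open>x1 y2 / M\<^sup>k\<^sup>+\<^sup>l\<close> and the integer \<open>x2 y1\<close>, which the exponential does not see.
\<close>

lemma char_sum_cantor_set_add:
  assumes "A \<subseteq> {..<M}" "M > 0"
  shows "char_sum (M ^ (k + l)) (cantor_set M A (k + l)) u (x1 + M ^ k * x2) =
    char_sum (M ^ l) (cantor_set M A l)
      (\<lambda>y2. cis (- (2 * pi * (real x1 * real y2) / real (M ^ (k + l)))) *
         char_sum (M ^ k) (cantor_set M A k) (\<lambda>y1. u (y2 + M ^ l * y1)) x1) x2"
proof -
  let ?p = "real (M ^ k)" and ?q = "real (M ^ l)"
  have pos: "?p > 0" "?q > 0" using assms by auto
  have N: "real (M ^ (l + k)) = ?p * ?q" by (simp add: power_add)
  have split: "cis (- (2 * pi * (real (x1 + M ^ k * x2) * real (y2 + M ^ l * y1)) / (?p * ?q))) =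
    cis (- (2 * pi * (real x2 * real y2) / ?q)) * cis (- (2 * pi * (real x1 * real y2) / (?p * ?q))) *
    cis (- (2 * pi * (real x1 * real y1) / ?p))" for y1 y2
  proof -
    have "- (2 * pi * (real (x1 + M ^ k * x2) * real (y2 + M ^ l * y1)) / (p * q)) =
      - (2 * pi * (real x2 * real y2) / q) + - (2 * pi * (real x1 * real y2) / (p * q)) +
      - (2 * pi * (real x1 * real y1) / p) + - (2 * pi * real (x2 * y1))"
      if "p = ?p" "q = ?q" for p q
      using pos unfolding of_nat_add of_nat_mult that[symmetric] by (simp add: field_simps)
    from this[OF refl refl] show ?thesis by (simp only: cis_mult[symmetric] cis_minus_2pi_nat mult_1_right)
  qed
  show ?thesis
    unfolding char_sum_def add.commute[of k l] sum_cantor_set_add[OF assms(1)] sum_distrib_left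
    by (intro sum.cong refl) (simp only: N split, simp only: mult.assoc)
qed

lemma fup_norm_nonneg: "A \<subseteq> {..<M} \<Longrightarrow> fup_norm M A k \<ge> 0"
  unfolding fup_norm_def by (intro localized_dft_norm_nonneg cantor_set_less)

text \<open>
  In the factorisation above the twiddle factors have modulus one, so the \<open>\<ell>\<^sup>2\<close> bounds for the two
  shorter transforms can be applied one after the other, each with the other variable as a parameter.
\<close>

lemma fup_norm_submult:
  assumes "A \<subseteq> {..<M}" "M > 0"
  shows "fup_norm M A (k + l) \<le> fup_norm M A k * fup_norm M A l"
proof -
  let ?C = "cantor_set M A" and ?r = "fup_norm M A"
  have bound: "(\<Sum>x\<in>?C k. (cmod (char_sum (M ^ k) (?C k) u x))\<^sup>2) \<le>
      real (M ^ k) * (?r k)\<^sup>2 * (\<Sum>y\<in>?C k. (cmod (u y))\<^sup>2)" for k u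
    unfolding fup_norm_def using assms by (intro char_sum_norm_le cantor_set_less) auto
  have "localized_dft_norm (M ^ (k + l)) (?C (k + l)) \<le> ?r k * ?r l"
  proof (rule localized_dft_norm_leI)
    fix u
    define v where "v x1 y2 = char_sum (M ^ k) (?C k) (\<lambda>y1. u (y2 + M ^ l * y1)) x1" for x1 y2
    define w where "w x1 y2 = cis (- (2 * pi * (real x1 * real y2) / real (M ^ (k + l)))) * v x1 y2" for x1 y2
    have "(\<Sum>x\<in>?C (k + l). (cmod (char_sum (M ^ (k + l)) (?C (k + l)) u x))\<^sup>2) =
      (\<Sum>x1\<in>?C k. \<Sum>x2\<in>?C l. (cmod (char_sum (M ^ l) (?C l) (w x1) x2))\<^sup>2)"
      unfolding sum_cantor_set_add[OF assms(1)] char_sum_cantor_set_add[OF assms] w_def v_def ..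
    also have "\<dots> \<le> (\<Sum>x1\<in>?C k. real (M ^ l) * (?r l)\<^sup>2 * (\<Sum>y2\<in>?C l. (cmod (w x1 y2))\<^sup>2))"
      by (intro sum_mono bound)
    also have "\<dots> = real (M ^ l) * (?r l)\<^sup>2 * (\<Sum>y2\<in>?C l. \<Sum>x1\<in>?C k. (cmod (v x1 y2))\<^sup>2)"
      by (subst sum.swap) (simp add: w_def norm_mult sum_distrib_left)
    also have "\<dots> \<le> real (M ^ l) * (?r l)\<^sup>2 *
        (\<Sum>y2\<in>?C l. real (M ^ k) * (?r k)\<^sup>2 * (\<Sum>y1\<in>?C k. (cmod (u (y2 + M ^ l * y1)))\<^sup>2))"
      unfolding v_def by (intro mult_left_mono sum_mono bound) auto
    also have "\<dots> = real (M ^ (k + l)) * (?r k * ?r l)\<^sup>2 * (\<Sum>y\<in>?C (l + k). (cmod (u y))\<^sup>2)"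
      unfolding sum_cantor_set_add[OF assms(1)]
      by (simp add: power_add power_mult_distrib sum_distrib_left[symmetric] mult_ac)
    finally show "(\<Sum>x\<in>?C (k + l). (cmod (char_sum (M ^ (k + l)) (?C (k + l)) u x))\<^sup>2)
      \<le> real (M ^ (k + l)) * (?r k * ?r l)\<^sup>2 * (\<Sum>y\<in>?C (k + l). (cmod (u y))\<^sup>2)"
      by (simp only: add.commute)
  qed (use assms cantor_set_less fup_norm_nonneg in auto)
  thus ?thesis unfolding fup_norm_def .
qed

section \<open>The test function\<close>

lemma cos_ge_1_minus: "1 - x\<^sup>2 / 2 \<le> cos (x::real)"
proof -
  have "(sin (x / 2))\<^sup>2 \<le> (x / 2)\<^sup>2"
    using abs_sin_x_le_abs_x abs_le_square_iff by blast
  thus ?thesis using cos_double_sin[of "x / 2"] by (simp add: power_divide)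
qed

text \<open>
  All phases \<open>2\<pi>bt\<close> are so small that the terms nearly point in the direction of \<open>1\<close>. By
  \<open>\<pi>\<^sup>2 \<le> 10\<close>, the real part of each is at least \<open>1 - 2\<pi>\<^sup>2s\<^sup>2 \<ge> 1 - 20s\<^sup>2\<close>, and \<open>20s\<^sup>2 \<le> 2s\<close> since
  \<open>s \<le> 1 / 10\<close>.
\<close>

lemma dirichlet_sum_lower:
  fixes t s :: real
  assumes "\<And>b. b < n \<Longrightarrow> real b * t \<le> s" "t \<ge> 0" "s \<le> 1 / 10"
  shows "real n * (1 - 2 * s) \<le> cmod (\<Sum>b<n. cis (- (2 * pi * (real b * t))))"
proof -
  have "1 - 2 * s \<le> cos (2 * pi * (real b * t))" if b: "b < n" for b
  proof -
    have bt: "0 \<le> real b * t" "real b * t \<le> s" using assms b by auto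
    have "(real b * t)\<^sup>2 \<le> s\<^sup>2" using bt by (intro power_mono)
    also have "\<dots> \<le> 1 / 10 * s" unfolding power2_eq_square using bt assms(3) by (intro mult_right_mono) auto
    finally have "(real b * t)\<^sup>2 \<le> s / 10" by simp
    moreover have "pi\<^sup>2 \<le> 10"
    proof -
      have "pi\<^sup>2 \<le> (3.15)\<^sup>2" using pi_approx by (intro power_mono) auto
      thus ?thesis by (simp add: power2_eq_square)
    qed
    ultimately have "pi\<^sup>2 * (real b * t)\<^sup>2 \<le> 10 * (s / 10)" by (intro mult_mono) auto
    thus ?thesis using cos_ge_1_minus[of "2 * pi * (real b * t)"] by (simp add: power_mult_distrib mult_ac)
  qed
  hence "(\<Sum>b<n. 1 - 2 * s) \<le> (\<Sum>b<n. cos (2 * pi * (real b * t)))"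
    by (intro sum_mono) auto
  also have "\<dots> = Re (\<Sum>b<n. cis (- (2 * pi * (real b * t))))" by simp
  also have "\<dots> \<le> cmod (\<Sum>b<n. cis (- (2 * pi * (real b * t))))" by (rule complex_Re_le_cmod)
  finally show ?thesis by simp
qed

text \<open>
  Each factor of the Riesz product is, up to a phase coming from \<open>a0\<close>, a Dirichlet sum at \<open>z / M\<^sup>m\<close>
  for some \<open>m \<le> k\<close>. Its fractional part is \<open>t = (z mod M\<^sup>m) / M\<^sup>m\<close>, and \<open>z mod M\<^sup>m\<close> again has digits
  below \<open>n\<close>, so \<open>t \<le> (n - 1) / (M - 1)\<close>. The digit \<open>b < n\<close> therefore has \<open>b t \<le> s\<close>.
\<close>

lemma cantor_set_fourier_lower:
  fixes s :: real
  assumes sub: "(\<lambda>j. a0 + j) ` {..<n} \<subseteq> {..<M}" and n: "n > 0" "n < M"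
    and s: "real n * (real n - 1) \<le> s * (real M - 1)" "s \<le> 1 / 10"
    and z: "z \<in> cantor_set M {..<n} k"
  shows "(real n * (1 - 2 * s)) ^ k \<le>
    cmod (\<Sum>y\<in>cantor_set M ((\<lambda>j. a0 + j) ` {..<n}) k. cis (- (2 * pi * real z / real (M ^ k)) * real y))"
proof -
  let ?\<theta> = "- (2 * pi * real z / real (M ^ k))"
  have M: "M > 1" using n by linarith
  have factor: "real n * (1 - 2 * s) \<le> cmod (\<Sum>a\<in>(\<lambda>j. a0 + j) ` {..<n}. cis (?\<theta> * real a * real (M ^ j)))"
    if j: "j < k" for j
  proof -
    define m where "m = k - j"
    have k: "k = m + j" using j by (simp add: m_def)
    define w where "w = z mod M ^ m"
    define q where "q = z div M ^ m"
    have zq: "z = q * M ^ m + w" unfolding w_def q_def by (rule div_mult_mod_eq[symmetric])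
    have w: "w \<in> cantor_set M {..<n} m"
      unfolding w_def using n by (intro cantor_set_mod[OF _ z]) (auto simp: m_def)
    define t where "t = real w / real (M ^ m)"
    have \<theta>: "?\<theta> * real b * real (M ^ j) = - (2 * pi * real (q * b)) + - (2 * pi * (real b * t))" for b
      unfolding t_def k zq using M by (simp add: power_add field_simps)
    have "(\<Sum>a\<in>(\<lambda>j. a0 + j) ` {..<n}. cis (?\<theta> * real a * real (M ^ j))) =
        (\<Sum>b<n. cis (?\<theta> * real (a0 + b) * real (M ^ j)))"
      by (subst sum.reindex) auto
    also have "\<dots> = (\<Sum>b<n. cis (?\<theta> * real a0 * real (M ^ j)) * cis (?\<theta> * real b * real (M ^ j)))"
      unfolding cis_mult by (intro sum.cong refl arg_cong[of _ _ cis]) (simp add: algebra_simps add_divide_distrib)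
    also have "\<dots> = cis (?\<theta> * real a0 * real (M ^ j)) * (\<Sum>b<n. cis (- (2 * pi * (real b * t))))"
      unfolding sum_distrib_left[symmetric] \<theta>
      by (simp only: cis_mult[symmetric] cis_minus_2pi_nat mult_1_left)
    finally have eq: "cmod (\<Sum>a\<in>(\<lambda>j. a0 + j) ` {..<n}. cis (?\<theta> * real a * real (M ^ j))) =
        cmod (\<Sum>b<n. cis (- (2 * pi * (real b * t))))" by (simp add: norm_mult)
    have "real b * t \<le> s" if b: "b < n" for b
    proof -
      have "real w * (real M - 1) \<le> (real n - 1) * (real (M ^ m) - 1)"
        using cantor_set_initial_le[OF w] M by simp
      also have "\<dots> \<le> (real n - 1) * real (M ^ m)"
        using n by (intro mult_left_mono) auto
      finally have t: "t * (real M - 1) \<le> real n - 1"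
        unfolding t_def using M by (simp add: field_simps)
      have "real b * t * (real M - 1) = real b * (t * (real M - 1))" by simp
      also have "\<dots> \<le> real n * (real n - 1)"
        using b t M by (intro mult_mono) (auto simp: t_def)
      also have "\<dots> \<le> s * (real M - 1)" by (rule s)
      finally show ?thesis using M by simp
    qed
    moreover have "t \<ge> 0" by (simp add: t_def)
    ultimately show ?thesis unfolding eq using s(2) by (intro dirichlet_sum_lower)
  qed
  have "(real n * (1 - 2 * s)) ^ k = (\<Prod>j<k. real n * (1 - 2 * s))" by simp
  also have "\<dots> \<le> (\<Prod>j<k. cmod (\<Sum>a\<in>(\<lambda>j. a0 + j) ` {..<n}. cis (?\<theta> * real a * real (M ^ j))))"
    using factor s(2) by (intro prod_mono) auto
  also have "\<dots> = cmod (\<Sum>y\<in>cantor_set M ((\<lambda>j. a0 + j) ` {..<n}) k. cis (?\<theta> * real y))"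
    unfolding sum_cis_cantor_set[OF sub] prod_norm ..
  finally show ?thesis .
qed

text \<open>
  The test function is the character of frequency \<open>c\<close> on the Cantor set \<open>D\<close> of the digits \<open>a0 + {0..<n}\<close>.
  Its squared norm is the cardinality of \<open>D\<close>, and its transform is at least
  \<open>(n (1 - 2 s))\<^sup>k / sqrt N\<close> in modulus at every point of \<open>D\<close>, so the cardinality cancels in the quotient.
  Letting \<open>n\<close> be smaller than the length of the alphabet keeps the phases under control
  for long alphabets.
\<close>

lemma fup_norm_lower:
  fixes s :: real
  assumes A: "A \<subseteq> {..<M}" and sub: "(\<lambda>j. a0 + j) ` {..<n} \<subseteq> A" and n: "n > 0" "n < M"
    and s: "real n * (real n - 1) \<le> s * (real M - 1)" "s \<le> 1 / 10"
  shows "(real n * (1 - 2 * s) / sqrt (real M)) ^ k \<le> fup_norm M A k"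
proof -
  define N where "N = M ^ k"
  define C where "C = cantor_set M A k"
  define D where "D = cantor_set M ((\<lambda>j. a0 + j) ` {..<n}) k"
  define E where "E = cantor_set M {..<n} k"
  define c where "c = a0 * (\<Sum>j<k. M ^ j)"
  define r where "r = fup_norm M A k"
  define g where "g = real n * (1 - 2 * s)"
  define u where "u y = indicator D y * cis (2 * pi * (real c * real y) / real N)" for y
  have N: "N > 0" using n by (simp add: N_def)
  have CN: "C \<subseteq> {..<N}" unfolding C_def N_def by (rule cantor_set_less[OF A])
  have fin: "finite C" using CN finite_subset by blast
  have DE: "D = (\<lambda>z. c + z) ` E" unfolding D_def E_def c_def by (rule cantor_set_translate)
  have DC: "D \<subseteq> C" unfolding D_def C_def by (rule cantor_set_mono[OF sub])
  have cardE: "card E = n ^ k" unfolding E_def using n by (subst card_cantor_set) auto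
  have cardD: "card D = n ^ k" unfolding DE by (subst card_image) (auto simp: cardE)
  have g0: "g \<ge> 0" using s(2) by (simp add: g_def)
  have "g ^ k \<le> cmod (char_sum N C u x)" if x: "x \<in> D" for x
  proof -
    obtain z where z: "x = c + z" "z \<in> E" using x DE by auto
    have "char_sum N C u x = (\<Sum>y\<in>D. cis (- (2 * pi * (real x * real y) / real N)) *
        cis (2 * pi * (real c * real y) / real N))"
      unfolding char_sum_def using DC fin
      by (intro sum.mono_neutral_cong_right) (auto simp: u_def indicator_def)
    also have "\<dots> = (\<Sum>y\<in>D. cis (- (2 * pi * real z / real N) * real y))"
      unfolding cis_mult z using N
      by (intro sum.cong refl arg_cong[of _ _ cis]) (simp add: field_simps)
    finally show ?thesis
      unfolding g_def using cantor_set_fourier_lower[OF order_trans[OF sub A] n s z(2)[unfolded E_def]]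
      by (simp add: D_def N_def)
  qed
  hence "real (card D) * (g ^ k)\<^sup>2 \<le> (\<Sum>x\<in>D. (cmod (char_sum N C u x))\<^sup>2)"
    using g0 by (intro sum_bounded_below power_mono) auto
  also have "\<dots> \<le> (\<Sum>x\<in>C. (cmod (char_sum N C u x))\<^sup>2)"
    using DC fin by (intro sum_mono2) auto
  also have "\<dots> \<le> real N * r\<^sup>2 * (\<Sum>y\<in>C. (cmod (u y))\<^sup>2)"
    unfolding r_def fup_norm_def C_def[symmetric] N_def[symmetric] by (rule char_sum_norm_le[OF CN N])
  also have "(\<Sum>y\<in>C. (cmod (u y))\<^sup>2) = (\<Sum>y\<in>D. 1)"
    using DC fin by (intro sum.mono_neutral_cong_right) (auto simp: u_def norm_mult)
  finally have "(g ^ k)\<^sup>2 \<le> real N * r\<^sup>2" using n by (simp add: cardD mult.commute)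
  also have "\<dots> = (sqrt (real M) ^ k * r)\<^sup>2"
    by (simp add: N_def power_mult_distrib power_mult[symmetric] mult.commute[of k] power_mult)
  finally have "g ^ k \<le> sqrt (real M) ^ k * r"
    by (rule power2_le_imp_le) (simp add: r_def fup_norm_nonneg[OF A])
  thus ?thesis using n unfolding g_def[symmetric] r_def[symmetric]
    by (simp add: power_divide field_simps)
qed

section \<open>From the norms to the exponent\<close>

text \<open>
  The lower bound has two uses: it bounds the limit, and it makes Fekete's lemma applicable by
  keeping \<open>ln (r\<^sub>k) / k\<close> bounded below.
\<close>

lemma fup_exponent_le:
  assumes A: "A \<subseteq> {..<M}" and M: "M > 1" and h: "h > 0"
    and lower: "\<And>k. h ^ k \<le> fup_norm M A k"
  shows "fup_exponent M A \<le> - ln h / ln (real M)"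
proof -
  let ?r = "fup_norm M A"
  have lnM: "ln (real M) > 0" using M by simp
  have pos: "?r k > 0" for k using lower[of k] zero_less_power[OF h, of k] by linarith
  define a where "a k = ln (?r k) / ln (real M)" for k
  have ge: "ln h / ln (real M) \<le> a k / real k" if "k > 0" for k
  proof -
    have "real k * ln h \<le> ln (?r k)"
      using lower[of k] pos[of k] h ln_le_cancel_iff[of "h ^ k" "?r k"] by (simp add: ln_realpow)
    thus ?thesis using that lnM by (simp add: a_def field_simps)
  qed
  have "convergent (\<lambda>k. a k / real k)"
  proof (rule subadditive_imp_convergent_quotient[OF _ ge])
    fix k l
    have "ln (?r (k + l)) \<le> ln (?r k * ?r l)"
      using fup_norm_submult[OF A, of k l] M pos by (subst ln_le_cancel_iff) auto
    also have "\<dots> = ln (?r k) + ln (?r l)" using pos by (simp add: ln_mult_pos)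
    finally show "a (k + l) \<le> a k + a l"
      using lnM by (simp add: a_def add_divide_distrib[symmetric] divide_right_mono)
  qed
  hence "(\<lambda>k. a k / real k) \<longlonglongrightarrow> lim (\<lambda>k. a k / real k)"
    by (simp add: convergent_LIMSEQ_iff)
  hence "ln h / ln (real M) \<le> lim (\<lambda>k. a k / real k)"
    by (rule LIMSEQ_le_const) (use ge in \<open>auto intro!: exI[of _ 1]\<close>)
  thus ?thesis unfolding fup_exponent_def by (simp add: a_def mult.commute)
qed

theorem proposition3p17:
  shows "\<exists>K::real. K > 0 \<and>
    (\<forall>M L a0 :: nat. 2 \<le> L \<longrightarrow> real L \<le> 2 * sqrt (real M) \<longrightarrow> L < M \<longrightarrow> a0 \<le> M - L \<longrightarrow>
      (let A = (\<lambda>j. a0 + j) ` {0..<L};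
           \<delta> = ln (real L) / ln (real M)
       in fup_exponent M A \<le> 1 / 2 - \<delta> + K * (real L)\<^sup>2 / (real M * ln (real M))))"
proof (intro exI[of _ "1000::real"] conjI allI impI)
  fix M L a0 :: nat
  assume L: "2 \<le> L" "real L \<le> 2 * sqrt (real M)" "L < M" "a0 \<le> M - L"
  define A where "A = (\<lambda>j. a0 + j) ` {0..<L}"
  define x where "x = (real L)\<^sup>2 / real M"
  have M: "real M > 2" using L by linarith
  have A: "A \<subseteq> {..<M}" using L by (auto simp: A_def)
  have "(real L)\<^sup>2 \<le> (2 * sqrt (real M))\<^sup>2" using L by (intro power_mono) auto
  hence L2: "(real L)\<^sup>2 \<le> 4 * real M" by (simp add: power_mult_distrib)
  \<comment> \<open>If \<open>x = L\<^sup>2 / M\<close> is small, all \<open>L\<close> digits are used with \<open>s = x\<close>. Otherwise about one digit in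
    seven is kept: since \<open>L\<^sup>2 \<le> 4 M\<close>, this gives \<open>n\<^sup>2 \<le> 4 M / 49 < M / 10\<close>.\<close>
  have "\<exists>n s. n > 0 \<and> n \<le> L \<and> real n * (real n - 1) \<le> s * (real M - 1) \<and> s \<le> 1 / 10
      \<and> real L * exp (- 1000 * x) \<le> real n * (1 - 2 * s)"
  proof (cases "x \<le> 1 / 10")
    case True
    have "exp (- 1000 * x) \<le> 1 - 2 * x"
    proof -
      have x0: "x \<ge> 0" by (simp add: x_def)
      have "1 \<le> (1 - 2 * x) * (1 + 1000 * x)"
      proof -
        have "x * x \<le> x * (1 / 10)" using True x0 by (intro mult_left_mono)
        thus ?thesis using x0 by (simp add: algebra_simps)
      qed
      also have "\<dots> \<le> (1 - 2 * x) * exp (1000 * x)"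
        using True by (intro mult_left_mono exp_ge_add_one_self) auto
      finally show ?thesis by (simp add: exp_minus field_simps)
    qed
    moreover have "real L * (real L - 1) \<le> x * (real M - 1)"
    proof -
      have "(real L)\<^sup>2 \<le> real L * real M" using L by (simp add: power2_eq_square)
      hence "x \<le> real L" using M by (simp add: x_def field_simps)
      moreover have "x * real M = real L * real L" using M by (simp add: x_def power2_eq_square)
      ultimately show ?thesis by (simp add: algebra_simps)
    qed
    ultimately show ?thesis using True L by (intro exI[of _ L] exI[of _ x]) auto
  next
    case False
    \<comment> \<open>For \<open>n = 1\<close> the phase bound is trivial, which covers the values of \<open>M\<close> for which \<open>n\<^sup>2 / M\<close> is
      not small.\<close>
    define n where "n = max 1 (L div 7)"
    have n0: "n > 0" "n \<le> L" using L by (auto simp: n_def)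
    have "real n * (real n - 1) \<le> 1 / 10 * (real M - 1)"
    proof (cases "n = 1")
      case False
      hence "7 * n \<le> L" by (auto simp: n_def max_def split: if_splits)
      hence "7 * real n \<le> real L" by linarith
      hence "(7 * real n)\<^sup>2 \<le> (real L)\<^sup>2" by (intro power_mono) auto
      hence "49 * (real n)\<^sup>2 \<le> 4 * real M" using L2 by (simp add: power_mult_distrib)
      thus ?thesis using n0 by (simp add: power2_eq_square algebra_simps)
    qed (use M in auto)
    moreover have "real L * exp (- 1000 * x) \<le> real n * (1 - 2 * (1 / 10))"
    proof -
      have "L \<le> 14 * n" by (auto simp: n_def max_def)
      hence "real L \<le> 14 * real n" by linarith
      moreover have "exp (- 1000 * x) \<le> 1 / 100"
      proof -
        have "100 \<le> exp (1000 * x)" using exp_ge_add_one_self[of "1000 * x"] False by linarith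
        thus ?thesis by (simp add: exp_minus field_simps)
      qed
      ultimately have "real L * exp (- 1000 * x) \<le> 14 * real n * (1 / 100)"
        by (intro mult_mono) auto
      thus ?thesis by simp
    qed
    ultimately show ?thesis using n0 by (intro exI[of _ n] exI[of _ "1/10"]) auto
  qed
  then obtain n s where n: "n > 0" "n \<le> L" and s: "real n * (real n - 1) \<le> s * (real M - 1)" "s \<le> 1 / 10"
    and ns: "real L * exp (- 1000 * x) \<le> real n * (1 - 2 * s)" by blast
  define h where "h = real n * (1 - 2 * s) / sqrt (real M)"
  have g0: "real n * (1 - 2 * s) > 0" using n s by auto
  have "fup_exponent M A \<le> - ln h / ln (real M)"
  proof (rule fup_exponent_le[OF A])
    show "h ^ k \<le> fup_norm M A k" for k
      unfolding h_def using A n s L by (intro fup_norm_lower[where ?a0.0 = a0]) (auto simp: A_def)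
    show "h > 0" using g0 M by (simp add: h_def)
  qed (use M in auto)
  also have "\<dots> \<le> (1 / 2 * ln (real M) - (ln (real L) - 1000 * x)) / ln (real M)"
  proof (rule divide_right_mono)
    have "ln (real L * exp (- 1000 * x)) \<le> ln (real n * (1 - 2 * s))"
      using ns g0 L by (subst ln_le_cancel_iff) auto
    moreover have "ln (real L * exp (- 1000 * x)) = ln (real L) - 1000 * x"
      using L by (simp add: ln_mult_pos)
    moreover have "ln h = ln (real n * (1 - 2 * s)) - ln (real M) / 2"
      unfolding h_def using g0 n M by (subst ln_div) (auto simp: ln_sqrt)
    ultimately show "- ln h \<le> 1 / 2 * ln (real M) - (ln (real L) - 1000 * x)" by linarith
  qed (use M in auto)
  also have "\<dots> = 1 / 2 - ln (real L) / ln (real M) + 1000 * (real L)\<^sup>2 / (real M * ln (real M))"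
    using M by (simp add: x_def field_simps)
  finally show "let A = (\<lambda>j. a0 + j) ` {0..<L}; \<delta> = ln (real L) / ln (real M)
       in fup_exponent M A \<le> 1 / 2 - \<delta> + 1000 * (real L)\<^sup>2 / (real M * ln (real M))"
    unfolding A_def Let_def .
qed simp

end
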